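(* The linear program $\mathbf L_H^{\mathcal X,\mathcal T}$ is the dual of the linear program $\mathbf L_P^{\mathcal X,\mathcal T}$ (both described in the context). Moreover an optimal solution to $\mathbf L_H^{\mathcal X,\mathcal T}$ exists and the optimal value of $\mathbf L_H^{\mathcal X,\mathcal T}$ equals the optimal value of $\mathbf L_P^{\mathcal X,\mathcal T}$.
   Context: Fix integers $N\ge1$, $J\ge1$, times $0=t_0<t_1<\dots<t_N=T$, $\mathcal T=\{t_1,\dots,t_N\}$, $s_0>0$, strikes $0<x_1<\dots<x_J$, $x_0=0$, $\mathcal X=\{x_0,\dots,x_J\}$. $\mathbf C=(c_{j,n})_{0\le j\le J,1\le n\le N}$, $c_{0,n}=s_0$, are call prices satisfying: (C1) $s_0=c_{0,n}\ge c_{1,n}\ge\dots\ge c_{J,n}\ge0$; (C2) $1\ge\frac{c_{0,n}-c_{1,n}}{x_1}\ge\frac{c_{1,n}-c_{2,n}}{x_2-x_1}\ge\dots\ge\frac{c_{J-1,n}-c_{J,n}}{x_J-x_{J-1}}$; (C3) $c_{j,n+1}\ge c_{j,n}$ for $1\le n\le N-1$; (C4) $c_{J,N}=0$. Set $p_{0,n}=1-\frac{s_0-c_{1,n}}{x_1}$, $p_{j,n}=\frac{c_{j-1,n}-c_{j,n}}{x_j-x_{j-1}}-\frac{c_{j,n}-c_{j+1,n}}{x_{j+1}-x_j}$ ($1\le j<J$), $p_{J,n}=\frac{c_{J-1,n}-c_{J,n}}{x_J-x_{J-1}}$. Let $a:\mathcal X\times\mathcal T\to[0,\infty)$. $\mathbf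 L_P^{\mathcal X,\mathcal T}$: over $f_{j,n}\ge0$ ($0\le j\le J,1\le n\le N$) and $g^\delta_{j,k,n}\ge0$ ($\delta\in\{1,2\}$, $0\le j,k\le J$, $1\le n\le N-1$), maximise $\sum_{n,j}a(x_j,t_n)f_{j,n}$ subject to: (a) $\sum_k(g^1_{j,k,n}+g^2_{j,k,n})=p_{j,n}$, $1\le n\le N-1$; (b) $\sum_i(g^1_{i,j,n-1}+g^2_{i,j,n-1})=p_{j,n}$, $2\le n\le N$; (c),(d) $\sum_k(x_k-x_j)g^\delta_{j,k,n}=0$, $\delta=1,2$, $1\le n\le N-1$; (e) $f_{j,1}-\sum_kg^2_{j,k,1}\le0$, $f_{j,n}-\sum_kg^2_{j,k,n}+\sum_ig^2_{i,j,n-1}\le0$ for $1<n<N$, $f_{j,N}+\sum_ig^2_{i,j,N-1}\le p_{j,N}$ (all $0\le j\le J$). $\mathbf L_H^{\mathcal X,\mathcal T}$: over reals $e^1_{j,n},e^2_{j,n},v_{j,n}$ ($0\le j\le J$, $1\le n\le N$) and $d^1_{j,n},d^2_{j,n}$ ($1\le n\le N-1$), with $e^1_{j,N}=e^2_{j,1}=0$, minimise $\sum_{j,n}(e^1_{j,n}+e^2_{j,n})p_{j,n}+\sum_jv_{j,N}p_{j,N}$ subject to $v_{j,n}\ge0$ and (i) $v_{j,n}\ge a(x_j,t_n)$; (ii) $e^1_{j,n}+e^2_{k,n+1}+(x_k-x_j)d^1_{j,n}\ge0$; (iii) $e^1_{j,n}+e^2_{k,n+1}+(x_k-x_j)d^2_{j,n}-v_{j,n}+v_{k,n+1}\ge0$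 for all $0\le j,k\le J$, $1\le n\le N-1$. *)

theory Defs
  imports Complex_Main
begin

definition market_data ::
  "nat \<Rightarrow> nat \<Rightarrow> (nat \<Rightarrow> real) \<Rightarrow> real \<Rightarrow> (nat \<Rightarrow> real) \<Rightarrow> (nat \<Rightarrow> nat \<Rightarrow> real) \<Rightarrow> bool" where
  "market_data N J t s0 x c \<longleftrightarrow>
     N \<ge> 1 \<and> J \<ge> 1 \<and> t 0 = 0 \<and> (\<forall>n<N. t n < t (Suc n)) \<and> s0 > 0 \<and>
     x 0 = 0 \<and> (\<forall>j<J. x j < x (Suc j)) \<and>
     (\<forall>n\<in>{1..N}. c 0 n = s0) \<and>
     \<comment> \<open>(C1)\<close>
     (\<forall>n\<in>{1..N}. (\<forall>j<J. c j n \<ge> c (Suc j) n) \<and> c J n \<ge> 0) \<and>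
     \<comment> \<open>(C2)\<close>
     (\<forall>n\<in>{1..N}. 1 \<ge> (c 0 n - c 1 n) / x 1 \<and>
        (\<forall>j. 1 \<le> j \<and> j < J \<longrightarrow>
           (c (j-1) n - c j n) / (x j - x (j-1)) \<ge> (c j n - c (Suc j) n) / (x (Suc j) - x j))) \<and>
     \<comment> \<open>(C3)\<close>
     (\<forall>n. 1 \<le> n \<and> n \<le> N - 1 \<longrightarrow> (\<forall>j\<le>J. c j (Suc n) \<ge> c j n)) \<and>
     \<comment> \<open>(C4)\<close>
     c J N = 0"

definition pr :: "nat \<Rightarrow> real \<Rightarrow> (nat \<Rightarrow> real) \<Rightarrow> (nat \<Rightarrow> nat \<Rightarrow> real) \<Rightarrow> nat \<Rightarrow> nat \<Rightarrow> real" where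
  "pr J s0 x c j n =
     (if j = 0 then 1 - (s0 - c 1 n) / x 1
      else if j < J then (c (j-1) n - c j n) / (x j - x (j-1)) - (c j n - c (Suc j) n) / (x (Suc j) - x j)
      else (c (J-1) n - c J n) / (x J - x (J-1)))"

definition LP_feasible ::
  "nat \<Rightarrow> nat \<Rightarrow> (nat \<Rightarrow> real) \<Rightarrow> (nat \<Rightarrow> nat \<Rightarrow> real)
   \<Rightarrow> (nat \<Rightarrow> nat \<Rightarrow> real) \<Rightarrow> (nat \<Rightarrow> nat \<Rightarrow> nat \<Rightarrow> real) \<Rightarrow> (nat \<Rightarrow> nat \<Rightarrow> nat \<Rightarrow> real) \<Rightarrow> bool" where
  "LP_feasible N J x p f g1 g2 \<longleftrightarrow>
     (\<forall>j\<le>J. \<forall>n\<in>{1..N}. f j n \<ge> 0) \<and>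
     (\<forall>j\<le>J. \<forall>k\<le>J. \<forall>n\<in>{1..N-1}. g1 j k n \<ge> 0 \<and> g2 j k n \<ge> 0) \<and>
     \<comment> \<open>(a)\<close>
     (\<forall>j\<le>J. \<forall>n\<in>{1..N-1}. (\<Sum>k\<le>J. g1 j k n + g2 j k n) = p j n) \<and>
     \<comment> \<open>(b)\<close>
     (\<forall>j\<le>J. \<forall>n\<in>{2..N}. (\<Sum>i\<le>J. g1 i j (n-1) + g2 i j (n-1)) = p j n) \<and>
     \<comment> \<open>(c), (d)\<close>
     (\<forall>j\<le>J. \<forall>n\<in>{1..N-1}. (\<Sum>k\<le>J. (x k - x j) * g1 j k n) = 0
                           \<and> (\<Sum>k\<le>J. (x k - x j) * g2 j k n) = 0) \<and>
     \<comment> \<open>(e)\<close>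
     (\<forall>j\<le>J.
        (1 < N \<longrightarrow> f j 1 - (\<Sum>k\<le>J. g2 j k 1) \<le> 0) \<and>
        (\<forall>n. 1 < n \<and> n < N \<longrightarrow> f j n - (\<Sum>k\<le>J. g2 j k n) + (\<Sum>i\<le>J. g2 i j (n-1)) \<le> 0) \<and>
        f j N + (if 1 < N then (\<Sum>i\<le>J. g2 i j (N-1)) else 0) \<le> p j N)"

definition LP_obj ::
  "nat \<Rightarrow> nat \<Rightarrow> (real \<Rightarrow> real \<Rightarrow> real) \<Rightarrow> (nat \<Rightarrow> real) \<Rightarrow> (nat \<Rightarrow> real) \<Rightarrow> (nat \<Rightarrow> nat \<Rightarrow> real) \<Rightarrow> real" where
  "LP_obj N J a x t f = (\<Sum>n\<in>{1..N}. \<Sum>j\<le>J. a (x j) (t n) * f j n)"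

definition LH_feasible ::
  "nat \<Rightarrow> nat \<Rightarrow> (real \<Rightarrow> real \<Rightarrow> real) \<Rightarrow> (nat \<Rightarrow> real) \<Rightarrow> (nat \<Rightarrow> real)
   \<Rightarrow> (nat \<Rightarrow> nat \<Rightarrow> real) \<Rightarrow> (nat \<Rightarrow> nat \<Rightarrow> real) \<Rightarrow> (nat \<Rightarrow> nat \<Rightarrow> real)
   \<Rightarrow> (nat \<Rightarrow> nat \<Rightarrow> real) \<Rightarrow> (nat \<Rightarrow> nat \<Rightarrow> real) \<Rightarrow> bool" where
  "LH_feasible N J a x t e1 e2 v d1 d2 \<longleftrightarrow>
     (\<forall>j\<le>J. e1 j N = 0 \<and> e2 j 1 = 0) \<and>
     (\<forall>j\<le>J. \<forall>n\<in>{1..N}. v j n \<ge> 0 \<and> v j n \<ge> a (x j) (t n)) \<and>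
     (\<forall>j\<le>J. \<forall>k\<le>J. \<forall>n\<in>{1..N-1}.
        e1 j n + e2 k (Suc n) + (x k - x j) * d1 j n \<ge> 0 \<and>
        e1 j n + e2 k (Suc n) + (x k - x j) * d2 j n - v j n + v k (Suc n) \<ge> 0)"

definition LH_obj ::
  "nat \<Rightarrow> nat \<Rightarrow> (nat \<Rightarrow> nat \<Rightarrow> real) \<Rightarrow> (nat \<Rightarrow> nat \<Rightarrow> real) \<Rightarrow> (nat \<Rightarrow> nat \<Rightarrow> real)
   \<Rightarrow> (nat \<Rightarrow> nat \<Rightarrow> real) \<Rightarrow> real" where
  "LH_obj N J p e1 e2 v =
     (\<Sum>n\<in>{1..N}. \<Sum>j\<le>J. (e1 j n + e2 j n) * p j n) + (\<Sum>j\<le>J. v j N * p j N)"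

end

theory Submission
  imports Defs
begin

text \<open>Written in standard form, with the variables \<open>f, g1, g2\<close> and the rows (a)--(e),
  \<open>L_P\<close> is a finite linear program whose dual is \<open>L_H\<close>: the dual variables of the rows
  (a), (b), (c), (d), (e) are \<open>e1, e2, d1, d2, v\<close>. By LP duality, proved here from the
  Farkas lemma, it suffices that both programs are feasible. For \<open>L_H\<close> take \<open>v\<close> constant,
  equal to a bound of \<open>a\<close>. Feasibility of \<open>L_P\<close> asks for martingale couplings of
  successive marginals \<open>p(\<cdot>, n)\<close> and \<open>p(\<cdot>, n + 1)\<close>; by the Farkas lemma an obstruction
  would be functions \<open>\<phi>, \<psi>, h\<close> on the strikes with \<open>\<phi> j + \<psi> k + (x k - x j) h j \<ge> 0\<close>
  for all \<open>j, k\<close> but \<open>E\<^sub>n \<phi> + E\<^sub>n\<^sub>+\<^sub>1 \<psi> < 0\<close>. The upper envelope \<open>g\<close> of the affine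
  functions \<open>y \<mapsto> - \<phi> j - h j (y - x j)\<close> is convex with \<open>- \<phi> \<le> g \<le> \<psi>\<close> on the grid,
  and \<open>E\<^sub>n g \<le> E\<^sub>n\<^sub>+\<^sub>1 g\<close> because, by (C3) and summation by parts, the marginals increase
  in convex order.\<close>

section \<open>The Farkas lemma and LP duality\<close>

definition dot :: "'k set \<Rightarrow> ('k \<Rightarrow> real) \<Rightarrow> ('k \<Rightarrow> real) \<Rightarrow> real" where
  "dot K y z = (\<Sum>k\<in>K. y k * z k)"

lemma dot_diff_right: "dot K y (\<lambda>k. s * u k - t * w k) = s * dot K y u - t * dot K y w"
  by (simp add: dot_def sum_subtractf sum_distrib_left algebra_simps)

lemma dot_diff_left: "dot K (\<lambda>k. s * u k - t * w k) z = s * dot K u z - t * dot K w z"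
  by (simp add: dot_def sum_subtractf sum_distrib_left algebra_simps)

definition in_cone :: "'k set \<Rightarrow> 'g set \<Rightarrow> ('g \<Rightarrow> 'k \<Rightarrow> real) \<Rightarrow> ('k \<Rightarrow> real) \<Rightarrow> bool" where
  "in_cone K G a b \<longleftrightarrow> (\<exists>l. (\<forall>g\<in>G. l g \<ge> 0) \<and> (\<forall>k\<in>K. b k = (\<Sum>g\<in>G. l g * a g k)))"

lemma in_cone_mono:
  assumes "finite G" "in_cone K G a b"
  shows "in_cone K (insert g0 G) a b"
proof -
  obtain l where l: "\<forall>g\<in>G. l g \<ge> 0" "\<forall>k\<in>K. b k = (\<Sum>g\<in>G. l g * a g k)"
    using assms(2) unfolding in_cone_def by blast
  show ?thesis
  proof (cases "g0 \<in> G")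
    case True then show ?thesis using assms(2) by (simp add: insert_absorb)
  next
    case False
    have "\<forall>k\<in>K. b k = (\<Sum>g\<in>insert g0 G. (l(g0 := 0)) g * a g k)"
      using l(2) assms(1) False by (auto intro!: sum.cong)
    then show ?thesis unfolding in_cone_def using l(1) by (intro exI[of _ "l(g0 := 0)"]) auto
  qed
qed

text \<open>Induction on the generators: if \<open>b\<close> is separated from the smaller cone by \<open>y\<close> but
  \<open>y\<close> fails on the new generator \<open>a g0\<close>, project everything along \<open>a g0\<close> so that the new
  generator is killed by the separating functional, and apply the induction hypothesis again.\<close>

lemma farkas_cone:
  assumes "finite K" "finite G"
  shows "in_cone K G a b \<or> (\<exists>y. (\<forall>g\<in>G. dot K y (a g) \<ge> 0) \<and> dot K y b < 0)"
  using assms(2)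
proof (induction G arbitrary: a b rule: finite_induct)
  case empty
  show ?case
  proof (cases "\<forall>k\<in>K. b k = 0")
    case True then show ?thesis unfolding in_cone_def by auto
  next
    case False
    then obtain k0 where k0: "k0 \<in> K" "b k0 \<noteq> 0" by auto
    have "0 < b k0 * b k0" using k0(2) not_real_square_gt_zero by blast
    also have "\<dots> \<le> (\<Sum>k\<in>K. b k * b k)"
      by (rule member_le_sum) (use k0 assms(1) in auto)
    finally have "dot K (\<lambda>k. - b k) b < 0" unfolding dot_def by (simp add: sum_negf)
    then show ?thesis by auto
  qed
next
  case (insert g0 G)
  show ?case
  proof (cases "in_cone K (insert g0 G) a b")
    case True then show ?thesis by blast
  next
    case not_cone: False
    with insert.IH[of a b] obtain y where y: "\<forall>g\<in>G. dot K y (a g) \<ge> 0" "dot K y b < 0"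
      using in_cone_mono[OF insert.hyps(1)] by blast
    show ?thesis
    proof (cases "dot K y (a g0) \<ge> 0")
      case True then show ?thesis using y by auto
    next
      case False
      define \<alpha> where "\<alpha> = dot K y (a g0)"
      have \<alpha>: "\<alpha> < 0" using False \<alpha>_def by simp
      define a' where "a' = (\<lambda>g k. dot K y (a g) * a g0 k - \<alpha> * a g k)"
      define b' where "b' = (\<lambda>k. dot K y b * a g0 k - \<alpha> * b k)"
      from insert.IH[of a' b'] show ?thesis
      proof
        assume "in_cone K G a' b'"
        then obtain m where m: "\<forall>g\<in>G. m g \<ge> 0" "\<forall>k\<in>K. b' k = (\<Sum>g\<in>G. m g * a' g k)"
          unfolding in_cone_def by blast
        define l0 where "l0 = (dot K y b - (\<Sum>g\<in>G. m g * dot K y (a g))) / \<alpha>"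
        have "(\<Sum>g\<in>G. m g * dot K y (a g)) \<ge> 0" using m y by (intro sum_nonneg) auto
        then have "l0 \<ge> 0" unfolding l0_def using \<alpha> y(2) by (intro divide_nonpos_neg) auto
        have "b k = (\<Sum>g\<in>insert g0 G. (m(g0 := l0)) g * a g k)" if k: "k \<in> K" for k
        proof -
          have "dot K y b * a g0 k - \<alpha> * b k
              = (\<Sum>g\<in>G. m g * dot K y (a g)) * a g0 k - \<alpha> * (\<Sum>g\<in>G. m g * a g k)"
            using m(2) k unfolding a'_def b'_def
            by (simp add: right_diff_distrib sum_subtractf sum_distrib_left sum_distrib_right mult_ac)
          then have "b k = l0 * a g0 k + (\<Sum>g\<in>G. m g * a g k)"
            unfolding l0_def using \<alpha> by (simp add: field_simps)
          also have "\<dots> = (\<Sum>g\<in>insert g0 G. (m(g0 := l0)) g * a g k)"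
            using insert.hyps by (auto intro!: sum.cong)
          finally show ?thesis .
        qed
        then have "in_cone K (insert g0 G) a b"
          unfolding in_cone_def using m(1) \<open>l0 \<ge> 0\<close> by (intro exI[of _ "m(g0 := l0)"]) auto
        then show ?thesis by blast
      next
        assume "\<exists>y'. (\<forall>g\<in>G. dot K y' (a' g) \<ge> 0) \<and> dot K y' b' < 0"
        then obtain y' where y': "\<forall>g\<in>G. dot K y' (a' g) \<ge> 0" "dot K y' b' < 0" by blast
        define z where "z = (\<lambda>k. dot K y' (a g0) * y k - \<alpha> * y' k)"
        have "dot K z (a g) = dot K y' (a' g)" for g
          unfolding z_def a'_def dot_diff_left dot_diff_right by (simp add: algebra_simps)
        moreover have "dot K z (a g0) = 0"
          unfolding z_def dot_diff_left \<alpha>_def by (simp add: algebra_simps)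
        moreover have "dot K z b = dot K y' b'"
          unfolding z_def b'_def dot_diff_left dot_diff_right by (simp add: algebra_simps)
        ultimately show ?thesis using y' by (intro disjI2 exI[of _ z]) auto
      qed
    qed
  qed
qed

definition matvec :: "'v set \<Rightarrow> ('i \<Rightarrow> 'v \<Rightarrow> real) \<Rightarrow> ('v \<Rightarrow> real) \<Rightarrow> 'i \<Rightarrow> real" where
  "matvec V A y i = (\<Sum>v\<in>V. A i v * y v)"

definition vecmat :: "'i set \<Rightarrow> ('i \<Rightarrow> 'v \<Rightarrow> real) \<Rightarrow> ('i \<Rightarrow> real) \<Rightarrow> 'v \<Rightarrow> real" where
  "vecmat I A u v = (\<Sum>i\<in>I. u i * A i v)"

lemma sum_Inl_Inr:
  assumes "finite S" "finite T"
  shows "(\<Sum>g\<in>Inl ` S \<union> Inr ` T. h g) = (\<Sum>s\<in>S. h (Inl s)) + (\<Sum>t\<in>T. h (Inr t))"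
  using assms by (subst sum.union_disjoint) (auto simp: sum.reindex)

text \<open>The mixed system is reduced to a conic one: a free variable \<open>v\<close> contributes the two
  generators \<open>\<plusminus>A v\<close> (tags \<open>True\<close>/\<open>False\<close>), an inequality row \<open>i\<close> the slack generator \<open>e i\<close>.\<close>

definition farkas_generators :: "'i set \<Rightarrow> 'i set \<Rightarrow> 'v set \<Rightarrow> 'v set \<Rightarrow> ('v \<times> bool + 'i) set" where
  "farkas_generators I Ieq V Vn = Inl ` (V \<times> {True} \<union> (V - Vn) \<times> {False}) \<union> Inr ` (I - Ieq)"

definition farkas_vector :: "('i \<Rightarrow> 'v \<Rightarrow> real) \<Rightarrow> 'v \<times> bool + 'i \<Rightarrow> 'i \<Rightarrow> real" where
  "farkas_vector A g i =
     (case g of Inl (v, s) \<Rightarrow> (if s then A i v else - A i v) | Inr i' \<Rightarrow> (if i' = i then 1 else 0))"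

lemma sum_farkas_generators:
  assumes "finite I" "finite V"
  shows "(\<Sum>g\<in>farkas_generators I Ieq V Vn. h g)
    = (\<Sum>v\<in>V. h (Inl (v, True))) + (\<Sum>v\<in>V - Vn. h (Inl (v, False))) + (\<Sum>i\<in>I - Ieq. h (Inr i))"
proof -
  have "(\<Sum>w\<in>V \<times> {True} \<union> (V - Vn) \<times> {False}. h (Inl w))
      = (\<Sum>w\<in>V \<times> {True}. h (Inl w)) + (\<Sum>w\<in>(V - Vn) \<times> {False}. h (Inl w))"
    using assms by (intro sum.union_disjoint) auto
  also have "\<dots> = (\<Sum>v\<in>V. h (Inl (v, True))) + (\<Sum>v\<in>V - Vn. h (Inl (v, False)))"
  proof -
    have e: "A \<times> {b} = (\<lambda>v. (v, b)) ` A" for A :: "'v set" and b :: bool by auto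
    show ?thesis by (subst (1 2) e) (simp add: sum.reindex inj_on_def)
  qed
  finally show ?thesis
    unfolding farkas_generators_def using assms by (subst sum_Inl_Inr) auto
qed

lemma matvec_cone_combination:
  assumes "finite I" "finite V" "i \<in> I"
  shows "(\<Sum>g\<in>farkas_generators I Ieq V Vn. l g * farkas_vector A g i)
    = matvec V A (\<lambda>v. l (Inl (v, True)) - (if v \<in> Vn then 0 else l (Inl (v, False)))) i
      + (if i \<in> Ieq then 0 else l (Inr i))"
proof -
  have "(\<Sum>v\<in>V - Vn. l (Inl (v, False)) * - A i v)
      = - (\<Sum>v\<in>V. A i v * (if v \<in> Vn then 0 else l (Inl (v, False))))"
    unfolding sum_negf[symmetric] using assms(2)
    by (intro sum.mono_neutral_cong_left) auto
  moreover have "(x::real) * (if P then 1 else 0) = (if P then x else 0)" for x P by simp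
  ultimately show ?thesis
    using assms by (simp add: sum_farkas_generators farkas_vector_def matvec_def algebra_simps
        sum_subtractf)
qed

lemma dot_farkas_vector:
  assumes "finite I"
  shows "dot I u (farkas_vector A (Inl (v, True))) = vecmat I A u v"
    and "dot I u (farkas_vector A (Inl (v, False))) = - vecmat I A u v"
    and "i \<in> I \<Longrightarrow> dot I u (farkas_vector A (Inr i)) = u i"
  using assms by (simp_all add: dot_def vecmat_def farkas_vector_def sum_negf if_distrib cong: if_cong)

lemma finite_farkas_generators: "finite I \<Longrightarrow> finite V \<Longrightarrow> finite (farkas_generators I Ieq V Vn)"
  unfolding farkas_generators_def by auto

lemma farkas_lemma:
  assumes fin: "finite I" "finite V" and sub: "Ieq \<subseteq> I" "Vn \<subseteq> V"
  shows "(\<exists>y. (\<forall>v\<in>Vn. y v \<ge> 0) \<and> (\<forall>i\<in>I - Ieq. matvec V A y i \<le> b i) \<and> (\<forall>i\<in>Ieq. matvec V A y i = b i))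
    \<or> (\<exists>u. (\<forall>i\<in>I - Ieq. u i \<ge> 0) \<and> (\<forall>v\<in>Vn. vecmat I A u v \<ge> 0) \<and> (\<forall>v\<in>V - Vn. vecmat I A u v = 0)
          \<and> (\<Sum>i\<in>I. b i * u i) < 0)"
  (is "?primal \<or> ?certificate")
proof -
  let ?G = "farkas_generators I Ieq V Vn"
  from farkas_cone[OF fin(1) finite_farkas_generators[OF fin], where a = "farkas_vector A" and b = b]
  show ?thesis
  proof
    assume "in_cone I ?G (farkas_vector A) b"
    then obtain l where l: "\<forall>g\<in>?G. l g \<ge> 0" "\<forall>i\<in>I. b i = (\<Sum>g\<in>?G. l g * farkas_vector A g i)"
      unfolding in_cone_def by blast
    define y where "y = (\<lambda>v. l (Inl (v, True)) - (if v \<in> Vn then 0 else l (Inl (v, False))))"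
    have b: "b i = matvec V A y i + (if i \<in> Ieq then 0 else l (Inr i))" if "i \<in> I" for i
      using l(2) that matvec_cone_combination[OF fin that] unfolding y_def by simp
    have "\<forall>v\<in>Vn. y v \<ge> 0" "\<forall>i\<in>I - Ieq. l (Inr i) \<ge> 0"
      using l(1) sub unfolding y_def farkas_generators_def by auto
    moreover have "\<forall>i\<in>I - Ieq. matvec V A y i \<le> b i" "\<forall>i\<in>Ieq. matvec V A y i = b i"
      using b calculation(2) sub by auto
    ultimately have ?primal by blast
    then show ?thesis ..
  next
    assume "\<exists>u. (\<forall>g\<in>?G. dot I u (farkas_vector A g) \<ge> 0) \<and> dot I u b < 0"
    then obtain u where u: "\<forall>g\<in>?G. dot I u (farkas_vector A g) \<ge> 0" "dot I u b < 0" by blast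
    have "Inr i \<in> ?G" if "i \<in> I - Ieq" for i
      using that unfolding farkas_generators_def by blast
    then have "\<forall>i\<in>I - Ieq. u i \<ge> 0"
      using u(1) dot_farkas_vector(3)[OF fin(1), of _ u A] by fastforce
    moreover have "Inl (v, True) \<in> ?G" "v \<in> V - Vn \<Longrightarrow> Inl (v, False) \<in> ?G" if "v \<in> V" for v
      using that unfolding farkas_generators_def by blast+
    then have "\<forall>v\<in>V. vecmat I A u v \<ge> 0" "\<forall>v\<in>V - Vn. vecmat I A u v \<le> 0"
      using u(1) dot_farkas_vector(1,2)[OF fin(1), of u A] by fastforce+
    then have "\<forall>v\<in>Vn. vecmat I A u v \<ge> 0" "\<forall>v\<in>V - Vn. vecmat I A u v = 0"
      using sub by (auto intro: order.antisym)
    moreover have "(\<Sum>i\<in>I. b i * u i) < 0" using u(2) unfolding dot_def by (simp add: mult.commute)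
    ultimately have ?certificate by blast
    then show ?thesis ..
  qed
qed

definition lp_primal_feasible ::
  "'i set \<Rightarrow> 'i set \<Rightarrow> 'v set \<Rightarrow> ('i \<Rightarrow> 'v \<Rightarrow> real) \<Rightarrow> ('i \<Rightarrow> real) \<Rightarrow> ('v \<Rightarrow> real) \<Rightarrow> bool" where
  "lp_primal_feasible I Ieq V A b y \<longleftrightarrow>
     (\<forall>v\<in>V. y v \<ge> 0) \<and> (\<forall>i\<in>I - Ieq. matvec V A y i \<le> b i) \<and> (\<forall>i\<in>Ieq. matvec V A y i = b i)"

definition lp_dual_feasible ::
  "'i set \<Rightarrow> 'i set \<Rightarrow> 'v set \<Rightarrow> ('i \<Rightarrow> 'v \<Rightarrow> real) \<Rightarrow> ('v \<Rightarrow> real) \<Rightarrow> ('i \<Rightarrow> real) \<Rightarrow> bool" where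
  "lp_dual_feasible I Ieq V A c u \<longleftrightarrow> (\<forall>i\<in>I - Ieq. u i \<ge> 0) \<and> (\<forall>v\<in>V. vecmat I A u v \<ge> c v)"

text \<open>Right-hand sides are scaled by \<open>\<tau>\<close> and \<open>\<sigma>\<close> because the degenerate scalings
  \<open>\<tau> = 0\<close> and \<open>\<sigma> = 0\<close> are needed to refute Farkas certificates.\<close>

lemma weak_duality_scaled:
  assumes fin: "finite I" "finite V" and sub: "Ieq \<subseteq> I"
    and y: "\<forall>v\<in>V. y v \<ge> 0" "\<forall>i\<in>I - Ieq. matvec V A y i \<le> \<tau> * b i" "\<forall>i\<in>Ieq. matvec V A y i = \<tau> * b i"
    and u: "\<forall>i\<in>I - Ieq. u i \<ge> 0" "\<forall>v\<in>V. vecmat I A u v \<ge> \<sigma> * c v"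
  shows "\<sigma> * (\<Sum>v\<in>V. c v * y v) \<le> \<tau> * (\<Sum>i\<in>I. b i * u i)"
proof -
  have "\<sigma> * (\<Sum>v\<in>V. c v * y v) = (\<Sum>v\<in>V. (\<sigma> * c v) * y v)"
    by (simp add: sum_distrib_left mult.assoc)
  also have "\<dots> \<le> (\<Sum>v\<in>V. vecmat I A u v * y v)"
    using y(1) u(2) by (intro sum_mono mult_right_mono) auto
  also have "\<dots> = (\<Sum>i\<in>I. u i * matvec V A y i)"
    unfolding vecmat_def matvec_def sum_distrib_left sum_distrib_right
    by (subst sum.swap) (simp add: mult.assoc)
  also have "\<dots> \<le> (\<Sum>i\<in>I. u i * (\<tau> * b i))"
    using y(2,3) u(1) by (intro sum_mono) (metis Diff_iff mult_left_mono order.refl)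
  also have "\<dots> = \<tau> * (\<Sum>i\<in>I. b i * u i)"
    by (simp add: sum_distrib_left algebra_simps)
  finally show ?thesis .
qed

lemma weak_duality:
  assumes "finite I" "finite V" "Ieq \<subseteq> I"
    and "lp_primal_feasible I Ieq V A b y" "lp_dual_feasible I Ieq V A c u"
  shows "(\<Sum>v\<in>V. c v * y v) \<le> (\<Sum>i\<in>I. b i * u i)"
  using weak_duality_scaled[of I V Ieq y A 1 b u 1 c] assms
  unfolding lp_primal_feasible_def lp_dual_feasible_def by simp

lemma duality_certificate_impossible:
  assumes fin: "finite I" "finite V" and sub: "Ieq \<subseteq> I"
    and y0: "lp_primal_feasible I Ieq V A b y0" and u0: "lp_dual_feasible I Ieq V A c u0"
    and \<tau>: "\<tau> \<ge> 0"
    and \<omega>: "\<forall>i\<in>I - Ieq. \<omega> i \<ge> 0" "\<forall>v\<in>V. vecmat I A \<omega> v \<ge> \<tau> * c v"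
    and \<epsilon>: "\<forall>v\<in>V. \<epsilon> v \<ge> 0" "\<forall>i\<in>I - Ieq. matvec V A \<epsilon> i \<le> \<tau> * b i" "\<forall>i\<in>Ieq. matvec V A \<epsilon> i = \<tau> * b i"
  shows "(\<Sum>v\<in>V. c v * \<epsilon> v) \<le> (\<Sum>i\<in>I. b i * \<omega> i)"
proof (cases "\<tau> > 0")
  case True
  have "\<tau> * (\<Sum>v\<in>V. c v * \<epsilon> v) \<le> \<tau> * (\<Sum>i\<in>I. b i * \<omega> i)"
    by (rule weak_duality_scaled[OF fin sub \<epsilon> \<omega>])
  then show ?thesis using True by simp
next
  case False
  then have "\<tau> = 0" using \<tau> by simp
  have "0 * (\<Sum>v\<in>V. c v * y0 v) \<le> 1 * (\<Sum>i\<in>I. b i * \<omega> i)"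
    by (rule weak_duality_scaled[OF fin sub]) (use y0 \<omega> \<open>\<tau> = 0\<close> in \<open>auto simp: lp_primal_feasible_def\<close>)
  moreover have "1 * (\<Sum>v\<in>V. c v * \<epsilon> v) \<le> 0 * (\<Sum>i\<in>I. b i * u0 i)"
    by (rule weak_duality_scaled[OF fin sub]) (use u0 \<epsilon> \<open>\<tau> = 0\<close> in \<open>auto simp: lp_dual_feasible_def\<close>)
  ultimately show ?thesis by simp
qed

text \<open>Strong duality is obtained by applying the Farkas lemma to the system
  "\<open>y\<close> primal feasible, \<open>u\<close> dual feasible, \<open>b \<bullet> u \<le> c \<bullet> y\<close>", whose rows are indexed below.\<close>

datatype ('i, 'v) duality_row = Primal_Row 'i | Dual_Row 'v | Gap_Row

definition duality_rows :: "'i set \<Rightarrow> 'v set \<Rightarrow> ('i, 'v) duality_row set" where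
  "duality_rows I V = Primal_Row ` I \<union> Dual_Row ` V \<union> {Gap_Row}"

definition duality_matrix ::
  "('i \<Rightarrow> 'v \<Rightarrow> real) \<Rightarrow> ('i \<Rightarrow> real) \<Rightarrow> ('v \<Rightarrow> real) \<Rightarrow> ('i, 'v) duality_row \<Rightarrow> 'v + 'i \<Rightarrow> real" where
  "duality_matrix A b c r z = (case r of
       Primal_Row i \<Rightarrow> (case z of Inl v \<Rightarrow> A i v | Inr _ \<Rightarrow> 0)
     | Dual_Row v \<Rightarrow> (case z of Inl _ \<Rightarrow> 0 | Inr i \<Rightarrow> - A i v)
     | Gap_Row \<Rightarrow> (case z of Inl v \<Rightarrow> - c v | Inr i \<Rightarrow> b i))"

definition duality_rhs :: "('i \<Rightarrow> real) \<Rightarrow> ('v \<Rightarrow> real) \<Rightarrow> ('i, 'v) duality_row \<Rightarrow> real" where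
  "duality_rhs b c r = (case r of Primal_Row i \<Rightarrow> b i | Dual_Row v \<Rightarrow> - c v | Gap_Row \<Rightarrow> 0)"

lemma sum_duality_rows:
  assumes "finite I" "finite V"
  shows "(\<Sum>r\<in>duality_rows I V. h r) = (\<Sum>i\<in>I. h (Primal_Row i)) + (\<Sum>v\<in>V. h (Dual_Row v)) + h Gap_Row"
proof -
  have "(\<Sum>r\<in>duality_rows I V. h r) = (\<Sum>r\<in>Primal_Row ` I. h r) + (\<Sum>r\<in>Dual_Row ` V. h r) + h Gap_Row"
    using assms unfolding duality_rows_def by (subst sum.union_disjoint, auto)+
  then show ?thesis by (simp add: sum.reindex inj_on_def)
qed

lemma matvec_duality_matrix:
  assumes "finite I" "finite V"
  shows "matvec (Inl ` V \<union> Inr ` I) (duality_matrix A b c) z (Primal_Row i) = matvec V A (z \<circ> Inl) i"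
    and "matvec (Inl ` V \<union> Inr ` I) (duality_matrix A b c) z (Dual_Row v) = - vecmat I A (z \<circ> Inr) v"
    and "matvec (Inl ` V \<union> Inr ` I) (duality_matrix A b c) z Gap_Row
      = (\<Sum>i\<in>I. b i * z (Inr i)) - (\<Sum>v\<in>V. c v * z (Inl v))"
  using assms
  by (simp_all add: matvec_def vecmat_def sum_Inl_Inr duality_matrix_def sum_negf mult.commute)

lemma vecmat_duality_matrix:
  assumes "finite I" "finite V"
  shows "vecmat (duality_rows I V) (duality_matrix A b c) w (Inl v)
      = vecmat I A (w \<circ> Primal_Row) v - w Gap_Row * c v"
    and "vecmat (duality_rows I V) (duality_matrix A b c) w (Inr i)
      = w Gap_Row * b i - matvec V A (w \<circ> Dual_Row) i"
  using assms
  by (simp_all add: matvec_def vecmat_def sum_duality_rows duality_matrix_def sum_negf mult.commute)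

lemma lp_strong_duality:
  assumes fin: "finite I" "finite V" and sub: "Ieq \<subseteq> I"
    and y0: "lp_primal_feasible I Ieq V A b y0" and u0: "lp_dual_feasible I Ieq V A c u0"
  shows "\<exists>y u. lp_primal_feasible I Ieq V A b y \<and> lp_dual_feasible I Ieq V A c u
           \<and> (\<Sum>v\<in>V. c v * y v) = (\<Sum>i\<in>I. b i * u i)"
proof -
  let ?R = "duality_rows I V" and ?Req = "Primal_Row ` Ieq"
  let ?W = "Inl ` V \<union> Inr ` I" and ?Wn = "Inl ` V \<union> Inr ` (I - Ieq)"
  let ?M = "duality_matrix A b c" and ?r = "duality_rhs b c"
  have rows: "Primal_Row i \<in> ?R - ?Req \<longleftrightarrow> i \<in> I - Ieq" "Dual_Row v \<in> ?R - ?Req \<longleftrightarrow> v \<in> V"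
    "Gap_Row \<in> ?R - ?Req" for i v
    unfolding duality_rows_def by auto
  have "finite ?R" "finite ?W" "?Req \<subseteq> ?R" "?Wn \<subseteq> ?W" using fin sub unfolding duality_rows_def by auto
  from farkas_lemma[OF this, of ?M ?r] show ?thesis
  proof (elim disjE exE conjE)
    fix z assume z: "\<forall>w\<in>?Wn. z w \<ge> 0" "\<forall>r\<in>?R - ?Req. matvec ?W ?M z r \<le> ?r r"
      "\<forall>r\<in>?Req. matvec ?W ?M z r = ?r r"
    let ?y = "z \<circ> Inl" and ?u = "z \<circ> Inr"
    have py: "lp_primal_feasible I Ieq V A b ?y"
      unfolding lp_primal_feasible_def
    proof (intro conjI ballI)
      show "?y v \<ge> 0" if "v \<in> V" for v using z(1) that by simp
      show "matvec V A ?y i \<le> b i" if "i \<in> I - Ieq" for i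
        using z(2)[rule_format, of "Primal_Row i"] rows(1)[of i] that
        by (simp add: matvec_duality_matrix(1)[OF fin] duality_rhs_def)
      show "matvec V A ?y i = b i" if "i \<in> Ieq" for i
        using z(3)[rule_format, of "Primal_Row i"] that
        by (simp add: matvec_duality_matrix(1)[OF fin] duality_rhs_def)
    qed
    have du: "lp_dual_feasible I Ieq V A c ?u"
      unfolding lp_dual_feasible_def
    proof (intro conjI ballI)
      show "?u i \<ge> 0" if "i \<in> I - Ieq" for i using z(1) that by simp
      show "vecmat I A ?u v \<ge> c v" if "v \<in> V" for v
        using z(2)[rule_format, of "Dual_Row v"] rows(2)[of v] that
        by (simp add: matvec_duality_matrix(2)[OF fin] duality_rhs_def)
    qed
    have "(\<Sum>i\<in>I. b i * ?u i) \<le> (\<Sum>v\<in>V. c v * ?y v)"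
      using z(2)[rule_format, OF rows(3)] by (simp add: matvec_duality_matrix(3)[OF fin] duality_rhs_def)
    with weak_duality[OF fin sub py du] py du show ?thesis by (intro exI conjI) auto
  next
    fix w assume w: "\<forall>r\<in>?R - ?Req. w r \<ge> 0" "\<forall>z\<in>?Wn. vecmat ?R ?M w z \<ge> 0"
      "\<forall>z\<in>?W - ?Wn. vecmat ?R ?M w z = 0" "(\<Sum>r\<in>?R. ?r r * w r) < 0"
    let ?\<omega> = "w \<circ> Primal_Row" and ?\<epsilon> = "w \<circ> Dual_Row" and ?\<tau> = "w Gap_Row"
    have "(\<Sum>v\<in>V. c v * ?\<epsilon> v) \<le> (\<Sum>i\<in>I. b i * ?\<omega> i)"
    proof (rule duality_certificate_impossible[OF fin sub y0 u0])
      show "?\<tau> \<ge> 0" "\<forall>i\<in>I - Ieq. ?\<omega> i \<ge> 0" "\<forall>v\<in>V. ?\<epsilon> v \<ge> 0"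
        using w(1) rows by auto
      show "\<forall>v\<in>V. vecmat I A ?\<omega> v \<ge> ?\<tau> * c v"
        using w(2) by (simp add: vecmat_duality_matrix(1)[OF fin] ball_Un)
      show "\<forall>i\<in>I - Ieq. matvec V A ?\<epsilon> i \<le> ?\<tau> * b i"
        using w(2) by (simp add: vecmat_duality_matrix(2)[OF fin] ball_Un)
      show "\<forall>i\<in>Ieq. matvec V A ?\<epsilon> i = ?\<tau> * b i"
      proof
        fix i assume "i \<in> Ieq"
        then have "Inr i \<in> ?W - ?Wn" using sub by auto
        from w(3)[rule_format, OF this] show "matvec V A ?\<epsilon> i = ?\<tau> * b i"
          by (simp add: vecmat_duality_matrix(2)[OF fin])
      qed
    qed
    moreover have "(\<Sum>r\<in>?R. ?r r * w r) = (\<Sum>i\<in>I. b i * ?\<omega> i) - (\<Sum>v\<in>V. c v * ?\<epsilon> v)"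
      using fin by (simp add: sum_duality_rows duality_rhs_def sum_negf)
    ultimately show ?thesis using w(4) by simp
  qed
qed

section \<open>Call prices and convex order\<close>

lemma market_dataD:
  assumes "market_data N J t s0 x c"
  shows "N \<ge> 1" "J \<ge> 1" "x 0 = 0" "\<And>j. j < J \<Longrightarrow> x j < x (Suc j)"
    "\<And>n. n \<in> {1..N} \<Longrightarrow> c 0 n = s0"
    "\<And>n j. n \<in> {1..N} \<Longrightarrow> j < J \<Longrightarrow> c j n \<ge> c (Suc j) n"
    "\<And>n. n \<in> {1..N} \<Longrightarrow> 1 \<ge> (c 0 n - c 1 n) / x 1"
    "\<And>n j. n \<in> {1..N} \<Longrightarrow> 1 \<le> j \<Longrightarrow> j < J \<Longrightarrow>
        (c (j-1) n - c j n) / (x j - x (j-1)) \<ge> (c j n - c (Suc j) n) / (x (Suc j) - x j)"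
    "\<And>n j. 1 \<le> n \<Longrightarrow> n < N \<Longrightarrow> j \<le> J \<Longrightarrow> c j (Suc n) \<ge> c j n"
    "c J N = 0" "\<And>n. n \<in> {1..N} \<Longrightarrow> c J n \<ge> 0"
  using assms unfolding market_data_def by auto

lemma market_data_call_top_zero:
  assumes md: "market_data N J t s0 x c" and n: "n \<in> {1..N}"
  shows "c J n = 0"
proof -
  have "c J n \<le> c J (n + m)" if "n + m \<le> N" for m
    using that
  proof (induction m)
    case (Suc m)
    then show ?case using market_dataD(9)[OF md, of "n + m" J] n by simp
  qed simp
  from this[of "N - n"] have "c J n \<le> c J N" using n by simp
  then show ?thesis using market_dataD(10,11)[OF md] n by (metis order.antisym)
qed

lemma pr_nonneg:
  assumes md: "market_data N J t s0 x c" and j: "j \<le> J" and n: "n \<in> {1..N}"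
  shows "pr J s0 x c j n \<ge> 0"
proof -
  note md = market_dataD[OF md]
  consider "j = 0" | "0 < j" "j < J" | "j = J" "j \<noteq> 0" using j by linarith
  then show ?thesis
  proof cases
    case 1 then show ?thesis using md(7)[OF n] md(5)[OF n] by (simp add: pr_def)
  next
    case 2 then show ?thesis using md(8)[OF n, of j] by (simp add: pr_def)
  next
    case 3
    then have "c (J-1) n \<ge> c J n" "x (J-1) < x J" using md(6)[OF n, of "J-1"] md(4)[of "J-1"] by auto
    then show ?thesis using 3 by (simp add: pr_def)
  qed
qed

lemma sum_weighted_by_differences:
  fixes D g :: "nat \<Rightarrow> real"
  assumes "m \<ge> 1"
  shows "(1 - D 0) * g 0 + (\<Sum>j\<in>{1..<m}. (D (j-1) - D j) * g j) + D (m-1) * g m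
       = g 0 + (\<Sum>j<m. D j * (g (Suc j) - g j))"
  using assms
proof (induction m rule: dec_induct)
  case (step m)
  then show ?case by (simp add: algebra_simps)
qed (simp add: algebra_simps)

lemma summation_by_parts:
  fixes d s :: "nat \<Rightarrow> real"
  assumes "d 0 = 0" "m \<ge> 1"
  shows "(\<Sum>j<m. (d j - d (Suc j)) * s j) = (\<Sum>j\<in>{1..<m}. d j * (s j - s (j-1))) - d m * s (m-1)"
  using assms(2)
proof (induction m rule: dec_induct)
  case (step m)
  then show ?case by (simp add: algebra_simps)
qed (simp add: assms(1))

definition grid_slope :: "(nat \<Rightarrow> real) \<Rightarrow> (nat \<Rightarrow> real) \<Rightarrow> nat \<Rightarrow> real" where
  "grid_slope x g j = (g (Suc j) - g j) / (x (Suc j) - x j)"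

lemma sum_pr_eq_slopes:
  assumes md: "market_data N J t s0 x c" and n: "n \<in> {1..N}"
  shows "(\<Sum>j\<le>J. pr J s0 x c j n * g j) = g 0 + (\<Sum>j<J. (c j n - c (Suc j) n) * grid_slope x g j)"
proof -
  note md = market_dataD[OF md]
  define D where "D = (\<lambda>j. (c j n - c (Suc j) n) / (x (Suc j) - x j))"
  have split: "{..J} = insert 0 (insert J {1..<J})" using md(2) by auto
  have "(\<Sum>j\<le>J. pr J s0 x c j n * g j)
      = pr J s0 x c 0 n * g 0 + pr J s0 x c J n * g J + (\<Sum>j\<in>{1..<J}. pr J s0 x c j n * g j)"
    unfolding split using md(2) by simp
  also have "\<dots> = (1 - D 0) * g 0 + (\<Sum>j\<in>{1..<J}. (D (j-1) - D j) * g j) + D (J-1) * g J"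
    using md(2,3) md(5)[OF n] by (auto simp: pr_def D_def intro!: sum.cong)
  also have "\<dots> = g 0 + (\<Sum>j<J. D j * (g (Suc j) - g j))"
    by (rule sum_weighted_by_differences[OF md(2)])
  finally show ?thesis by (simp add: D_def grid_slope_def)
qed

lemma sum_pr_mono_convex:
  assumes md: "market_data N J t s0 x c" and n: "1 \<le> n" "n < N"
    and convex: "\<And>j. 1 \<le> j \<Longrightarrow> j < J \<Longrightarrow> grid_slope x g (j-1) \<le> grid_slope x g j"
  shows "(\<Sum>j\<le>J. pr J s0 x c j n * g j) \<le> (\<Sum>j\<le>J. pr J s0 x c j (Suc n) * g j)"
proof -
  note md' = market_dataD[OF md]
  have n1: "n \<in> {1..N}" and n2: "Suc n \<in> {1..N}" using n by auto
  define d where "d = (\<lambda>j. c j (Suc n) - c j n)"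
  have "d 0 = 0" "d J = 0"
    unfolding d_def using md'(5)[OF n1] md'(5)[OF n2] market_data_call_top_zero[OF md] n1 n2 by auto
  have "(\<Sum>j\<le>J. pr J s0 x c j (Suc n) * g j) - (\<Sum>j\<le>J. pr J s0 x c j n * g j)
      = (\<Sum>j<J. (d j - d (Suc j)) * grid_slope x g j)"
    unfolding sum_pr_eq_slopes[OF md n1] sum_pr_eq_slopes[OF md n2] d_def
    by (simp add: sum_subtractf[symmetric] algebra_simps)
  also have "\<dots> = (\<Sum>j\<in>{1..<J}. d j * (grid_slope x g j - grid_slope x g (j-1)))"
    using summation_by_parts[where d = d, OF \<open>d 0 = 0\<close> md'(2)] \<open>d J = 0\<close> by simp
  also have "\<dots> \<ge> 0"
    using md'(9) n convex unfolding d_def by (intro sum_nonneg mult_nonneg_nonneg) auto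
  finally show ?thesis by simp
qed

lemma slopes_le_of_supporting_line:
  fixes a b c Ga Gb Gc \<alpha> \<beta> :: real
  assumes "a < b" "b < c" "Gb = \<alpha> + \<beta> * b" "\<alpha> + \<beta> * a \<le> Ga" "\<alpha> + \<beta> * c \<le> Gc"
  shows "(Gb - Ga) / (b - a) \<le> (Gc - Gb) / (c - b)"
proof -
  have "(Gb - Ga) / (b - a) \<le> \<beta>"
    using assms by (simp add: divide_le_eq algebra_simps)
  also have "\<beta> \<le> (Gc - Gb) / (c - b)"
    using assms by (simp add: le_divide_eq algebra_simps)
  finally show ?thesis .
qed

text \<open>The separating function is the upper envelope of the affine functions
  \<open>y \<mapsto> - \<phi> i - h i * (y - x i)\<close>, evaluated on the grid.\<close>

lemma exists_convex_between:
  fixes \<phi> \<psi> h x :: "nat \<Rightarrow> real"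
  assumes grid: "\<And>j. j < J \<Longrightarrow> x j < x (Suc j)"
    and sep: "\<And>j k. j \<le> J \<Longrightarrow> k \<le> J \<Longrightarrow> \<phi> j + \<psi> k + (x k - x j) * h j \<ge> 0"
  shows "\<exists>g. (\<forall>j\<le>J. - \<phi> j \<le> g j) \<and> (\<forall>k\<le>J. g k \<le> \<psi> k)
           \<and> (\<forall>j. 1 \<le> j \<and> j < J \<longrightarrow> grid_slope x g (j-1) \<le> grid_slope x g j)"
proof -
  define L where "L = (\<lambda>i y. - \<phi> i - h i * (y - x i))"
  define \<Gamma> where "\<Gamma> = (\<lambda>y. Max ((\<lambda>i. L i y) ` {..J}))"
  have L_le: "L i y \<le> \<Gamma> y" if "i \<le> J" for i y
    unfolding \<Gamma>_def using that by (intro Max_ge) auto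
  have \<Gamma>_attained: "\<exists>i\<le>J. \<Gamma> y = L i y" for y
  proof -
    have "\<Gamma> y \<in> (\<lambda>i. L i y) ` {..J}" unfolding \<Gamma>_def by (intro Max_in) auto
    then show ?thesis by auto
  qed
  have "- \<phi> j \<le> \<Gamma> (x j)" if "j \<le> J" for j
    using L_le[OF that, of "x j"] unfolding L_def by simp
  moreover have "\<Gamma> (x k) \<le> \<psi> k" if "k \<le> J" for k
    unfolding \<Gamma>_def using sep[OF _ that] by (subst Max_le_iff) (auto simp: L_def algebra_simps)
  moreover have "grid_slope x (\<lambda>k. \<Gamma> (x k)) (j-1) \<le> grid_slope x (\<lambda>k. \<Gamma> (x k)) j"
    if "1 \<le> j" "j < J" for j
  proof -
    obtain i where i: "i \<le> J" "\<Gamma> (x j) = L i (x j)" using \<Gamma>_attained by blast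
    have "x (j-1) < x j" "x j < x (Suc j)" using grid[of "j-1"] grid[of j] that by auto
    then have "(\<Gamma> (x j) - \<Gamma> (x (j-1))) / (x j - x (j-1)) \<le> (\<Gamma> (x (Suc j)) - \<Gamma> (x j)) / (x (Suc j) - x j)"
      using L_le[OF i(1), of "x (j-1)"] L_le[OF i(1), of "x (Suc j)"] i(2)
      by (intro slopes_le_of_supporting_line[where \<alpha> = "- \<phi> i + h i * x i" and \<beta> = "- h i"])
        (auto simp: L_def algebra_simps)
    then show ?thesis unfolding grid_slope_def using that by simp
  qed
  ultimately show ?thesis by (intro exI[of _ "\<lambda>k. \<Gamma> (x k)"]) auto
qed

lemma convex_order_dual_nonneg:
  assumes md: "market_data N J t s0 x c" and n: "1 \<le> n" "n < N"
    and sep: "\<And>j k. j \<le> J \<Longrightarrow> k \<le> J \<Longrightarrow> \<phi> j + \<psi> k + (x k - x j) * h j \<ge> 0"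
  shows "(\<Sum>j\<le>J. pr J s0 x c j n * \<phi> j) + (\<Sum>k\<le>J. pr J s0 x c k (Suc n) * \<psi> k) \<ge> 0"
proof -
  obtain g where g: "\<forall>j\<le>J. - \<phi> j \<le> g j" "\<forall>k\<le>J. g k \<le> \<psi> k"
    and convex: "\<forall>j. 1 \<le> j \<and> j < J \<longrightarrow> grid_slope x g (j-1) \<le> grid_slope x g j"
    using exists_convex_between[where J = J and x = x, OF market_dataD(4)[OF md] sep] by blast
  have n1: "n \<in> {1..N}" and n2: "Suc n \<in> {1..N}" using n by auto
  have "(\<Sum>j\<le>J. pr J s0 x c j n * g j) \<le> (\<Sum>j\<le>J. pr J s0 x c j (Suc n) * g j)"
    using sum_pr_mono_convex[OF md n] convex by blast
  moreover have "(\<Sum>j\<le>J. pr J s0 x c j n * - g j) \<le> (\<Sum>j\<le>J. pr J s0 x c j n * \<phi> j)"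
    using g(1) pr_nonneg[OF md _ n1] by (intro sum_mono mult_left_mono) auto
  moreover have "(\<Sum>k\<le>J. pr J s0 x c k (Suc n) * g k) \<le> (\<Sum>k\<le>J. pr J s0 x c k (Suc n) * \<psi> k)"
    using g(2) pr_nonneg[OF md _ n2] by (intro sum_mono mult_left_mono) auto
  ultimately show ?thesis by (simp add: sum_negf)
qed

section \<open>The program \<open>L_P\<close> in standard form\<close>

text \<open>The three cases of constraint (e) are merged into a single row shape: the \<open>g\<^sup>2\<close>-outflow
  at time \<open>n\<close> occurs for \<open>n < N\<close>, the inflow from time \<open>n - 1\<close> for \<open>n \<ge> 2\<close>, and the
  right-hand side is \<open>p j N\<close> at \<open>n = N\<close> and \<open>0\<close> otherwise.\<close>

datatype lp_var = Var_f nat nat | Var_g1 nat nat nat | Var_g2 nat nat nat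
datatype lp_row = Row_a nat nat | Row_b nat nat | Row_c nat nat | Row_d nat nat | Row_e nat nat

fun LP_matrix :: "(nat \<Rightarrow> real) \<Rightarrow> lp_row \<Rightarrow> lp_var \<Rightarrow> real" where
  "LP_matrix x (Row_a j n) (Var_g1 j' k n') = (if j' = j then if n' = n then 1 else 0 else 0)"
| "LP_matrix x (Row_a j n) (Var_g2 j' k n') = (if j' = j then if n' = n then 1 else 0 else 0)"
| "LP_matrix x (Row_b k n) (Var_g1 j k' n') = (if k' = k then if Suc n' = n then 1 else 0 else 0)"
| "LP_matrix x (Row_b k n) (Var_g2 j k' n') = (if k' = k then if Suc n' = n then 1 else 0 else 0)"
| "LP_matrix x (Row_c j n) (Var_g1 j' k n') = (if j' = j then if n' = n then x k - x j else 0 else 0)"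
| "LP_matrix x (Row_d j n) (Var_g2 j' k n') = (if j' = j then if n' = n then x k - x j else 0 else 0)"
| "LP_matrix x (Row_e j n) (Var_f j' n') = (if j' = j then if n' = n then 1 else 0 else 0)"
| "LP_matrix x (Row_e j n) (Var_g2 j' k n') = (if j' = j then if n' = n then -1 else 0 else 0)
                                 + (if k = j then if Suc n' = n then 1 else 0 else 0)"
| "LP_matrix x _ _ = 0"

definition LP_vars :: "nat \<Rightarrow> nat \<Rightarrow> lp_var set" where
  "LP_vars J N = (\<lambda>(j,n). Var_f j n) ` ({..J} \<times> {1..N})
          \<union> (\<lambda>(j,k,n). Var_g1 j k n) ` ({..J} \<times> {..J} \<times> {1..N-1})
          \<union> (\<lambda>(j,k,n). Var_g2 j k n) ` ({..J} \<times> {..J} \<times> {1..N-1})"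

definition LP_eq_rows :: "nat \<Rightarrow> nat \<Rightarrow> lp_row set" where
  "LP_eq_rows J N = (\<lambda>(j,n). Row_a j n) ` ({..J} \<times> {1..N-1}) \<union> (\<lambda>(j,n). Row_b j n) ` ({..J} \<times> {2..N})
           \<union> (\<lambda>(j,n). Row_c j n) ` ({..J} \<times> {1..N-1}) \<union> (\<lambda>(j,n). Row_d j n) ` ({..J} \<times> {1..N-1})"

definition LP_ineq_rows :: "nat \<Rightarrow> nat \<Rightarrow> lp_row set" where
  "LP_ineq_rows J N = (\<lambda>(j,n). Row_e j n) ` ({..J} \<times> {1..N})"

abbreviation LP_rows :: "nat \<Rightarrow> nat \<Rightarrow> lp_row set" where
  "LP_rows J N \<equiv> LP_eq_rows J N \<union> LP_ineq_rows J N"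

lemma sum_image_curry2:
  assumes "\<And>a b a' b'. f a b = f a' b' \<Longrightarrow> a = a' \<and> b = b'"
  shows "(\<Sum>z\<in>(\<lambda>(a,b). f a b) ` (A \<times> B). h z) = (\<Sum>a\<in>A. \<Sum>b\<in>B. h (f a b))"
proof -
  have "inj_on (\<lambda>(a,b). f a b) (A \<times> B)" using assms by (auto simp: inj_on_def)
  then have "(\<Sum>z\<in>(\<lambda>(a,b). f a b) ` (A \<times> B). h z) = (\<Sum>z\<in>A \<times> B. h (case z of (a,b) \<Rightarrow> f a b))"
    by (simp add: sum.reindex)
  also have "\<dots> = (\<Sum>a\<in>A. \<Sum>b\<in>B. h (f a b))"
    by (simp add: sum.cartesian_product split_def)
  finally show ?thesis .
qed

lemma sum_image_curry3:
  assumes "\<And>a b c a' b' c'. f a b c = f a' b' c' \<Longrightarrow> a = a' \<and> b = b' \<and> c = c'"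
  shows "(\<Sum>z\<in>(\<lambda>(a,b,c). f a b c) ` (A \<times> B \<times> C). h z) = (\<Sum>a\<in>A. \<Sum>b\<in>B. \<Sum>c\<in>C. h (f a b c))"
proof -
  have "inj_on (\<lambda>(a,b,c). f a b c) (A \<times> B \<times> C)" using assms by (auto simp: inj_on_def)
  then have "(\<Sum>z\<in>(\<lambda>(a,b,c). f a b c) ` (A \<times> B \<times> C). h z)
      = (\<Sum>z\<in>A \<times> B \<times> C. h (case z of (a,b,c) \<Rightarrow> f a b c))"
    by (simp add: sum.reindex)
  also have "\<dots> = (\<Sum>a\<in>A. \<Sum>b\<in>B. \<Sum>c\<in>C. h (f a b c))"
    by (simp add: sum.cartesian_product split_def)
  finally show ?thesis .
qed

lemmas sum_image_LP =
  sum_image_curry2[where f = Var_f, simplified] sum_image_curry3[where f = Var_g1, simplified]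
  sum_image_curry3[where f = Var_g2, simplified] sum_image_curry2[where f = Row_a, simplified]
  sum_image_curry2[where f = Row_b, simplified] sum_image_curry2[where f = Row_c, simplified]
  sum_image_curry2[where f = Row_d, simplified] sum_image_curry2[where f = Row_e, simplified]

lemma sum_LP_vars:
  "(\<Sum>v\<in>LP_vars J N. h v) = (\<Sum>j\<le>J. \<Sum>n\<in>{1..N}. h (Var_f j n)) + (\<Sum>j\<le>J. \<Sum>k\<le>J. \<Sum>n\<in>{1..N-1}. h (Var_g1 j k n))
      + (\<Sum>j\<le>J. \<Sum>k\<le>J. \<Sum>n\<in>{1..N-1}. h (Var_g2 j k n))"
  unfolding LP_vars_def
  by (subst sum.union_disjoint, force, force, force, subst sum.union_disjoint, force, force, force,
      simp only: sum_image_LP)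

lemma sum_LP_eq_rows:
  "(\<Sum>r\<in>LP_eq_rows J N. h r) = (\<Sum>j\<le>J. \<Sum>n\<in>{1..N-1}. h (Row_a j n)) + (\<Sum>j\<le>J. \<Sum>n\<in>{2..N}. h (Row_b j n))
      + (\<Sum>j\<le>J. \<Sum>n\<in>{1..N-1}. h (Row_c j n)) + (\<Sum>j\<le>J. \<Sum>n\<in>{1..N-1}. h (Row_d j n))"
  unfolding LP_eq_rows_def
  by (subst sum.union_disjoint, force, force, force, subst sum.union_disjoint, force, force, force,
      subst sum.union_disjoint, force, force, force, simp only: sum_image_LP)

lemma sum_LP_ineq_rows:
  "(\<Sum>r\<in>LP_ineq_rows J N. h r) = (\<Sum>j\<le>J. \<Sum>n\<in>{1..N}. h (Row_e j n))"
  unfolding LP_ineq_rows_def by (simp only: sum_image_LP)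

lemma finite_LP_sets: "finite (LP_vars J N)" "finite (LP_eq_rows J N)" "finite (LP_ineq_rows J N)"
  unfolding LP_vars_def LP_eq_rows_def LP_ineq_rows_def by auto

lemma LP_rows_disjoint:
  "LP_eq_rows J N \<inter> LP_ineq_rows J N = {}" "LP_rows J N - LP_eq_rows J N = LP_ineq_rows J N"
  unfolding LP_eq_rows_def LP_ineq_rows_def by auto

lemma sum_if_const: "(\<Sum>x\<in>S. if P then f x else 0) = (if P then (\<Sum>x\<in>S. f x) else (0::real))"
  by simp

lemma if_mult0: "(if P then a else 0) * (y::real) = (if P then a * y else 0)"
  and mult_if0: "(y::real) * (if P then a else 0) = (if P then y * a else 0)"
  by auto

lemma sum_Suc_delta:
  assumes "finite S"
  shows "(\<Sum>n'\<in>S. if Suc n' = n then f n' else 0) = (if n \<noteq> 0 \<and> n - 1 \<in> S then f (n - 1) else (0::real))"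
proof (cases n)
  case 0 then show ?thesis by simp
next
  case (Suc m)
  then have "(\<Sum>n'\<in>S. if Suc n' = n then f n' else 0) = (\<Sum>n'\<in>S. if n' = m then f n' else 0)" by simp
  then show ?thesis using assms Suc by (simp add: sum.delta)
qed

lemmas LP_simps = sum_if_const if_mult0 mult_if0 sum.delta sum.delta' sum_Suc_delta
  distrib_left distrib_right sum.distrib

lemma matvec_LP_row_a:
  assumes "j \<le> J" "1 \<le> n" "n < N"
  shows "matvec (LP_vars J N) (LP_matrix x) y (Row_a j n) = (\<Sum>k\<le>J. y (Var_g1 j k n) + y (Var_g2 j k n))"
  unfolding matvec_def sum_LP_vars using assms by (auto simp: LP_simps)

lemma matvec_LP_row_b:
  assumes "k \<le> J" "2 \<le> n" "n \<le> N"
  shows "matvec (LP_vars J N) (LP_matrix x) y (Row_b k n)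
    = (\<Sum>i\<le>J. y (Var_g1 i k (n-1)) + y (Var_g2 i k (n-1)))"
  unfolding matvec_def sum_LP_vars using assms by (auto simp: LP_simps)

lemma matvec_LP_row_c:
  assumes "j \<le> J" "1 \<le> n" "n < N"
  shows "matvec (LP_vars J N) (LP_matrix x) y (Row_c j n) = (\<Sum>k\<le>J. (x k - x j) * y (Var_g1 j k n))"
  unfolding matvec_def sum_LP_vars using assms by (auto simp: LP_simps)

lemma matvec_LP_row_d:
  assumes "j \<le> J" "1 \<le> n" "n < N"
  shows "matvec (LP_vars J N) (LP_matrix x) y (Row_d j n) = (\<Sum>k\<le>J. (x k - x j) * y (Var_g2 j k n))"
  unfolding matvec_def sum_LP_vars using assms by (auto simp: LP_simps)

lemma matvec_LP_row_e:
  assumes "j \<le> J" "1 \<le> n" "n \<le> N"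
  shows "matvec (LP_vars J N) (LP_matrix x) y (Row_e j n)
    = y (Var_f j n) - (if n < N then (\<Sum>k\<le>J. y (Var_g2 j k n)) else 0)
           + (if 2 \<le> n then (\<Sum>i\<le>J. y (Var_g2 i j (n-1))) else 0)"
  unfolding matvec_def sum_LP_vars using assms by (auto simp: LP_simps sum_negf)

lemma sum_LP_rows:
  "(\<Sum>r\<in>LP_rows J N. h r) = (\<Sum>r\<in>LP_eq_rows J N. h r) + (\<Sum>r\<in>LP_ineq_rows J N. h r)"
  by (rule sum.union_disjoint) (auto simp: finite_LP_sets LP_rows_disjoint)

lemma vecmat_LP_var_f:
  assumes "j \<le> J" "1 \<le> n" "n \<le> N"
  shows "vecmat (LP_rows J N) (LP_matrix x) u (Var_f j n) = u (Row_e j n)"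
  unfolding vecmat_def sum_LP_rows sum_LP_eq_rows sum_LP_ineq_rows using assms by (auto simp: LP_simps)

lemma vecmat_LP_var_g1:
  assumes "j \<le> J" "k \<le> J" "1 \<le> n" "n < N"
  shows "vecmat (LP_rows J N) (LP_matrix x) u (Var_g1 j k n)
    = u (Row_a j n) + u (Row_b k (Suc n)) + (x k - x j) * u (Row_c j n)"
  unfolding vecmat_def sum_LP_rows sum_LP_eq_rows sum_LP_ineq_rows using assms by (auto simp: LP_simps)

lemma vecmat_LP_var_g2:
  assumes "j \<le> J" "k \<le> J" "1 \<le> n" "n < N"
  shows "vecmat (LP_rows J N) (LP_matrix x) u (Var_g2 j k n)
    = u (Row_a j n) + u (Row_b k (Suc n)) + (x k - x j) * u (Row_d j n)
      - u (Row_e j n) + u (Row_e k (Suc n))"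
  unfolding vecmat_def sum_LP_rows sum_LP_eq_rows sum_LP_ineq_rows using assms by (auto simp: LP_simps)

definition LP_rhs :: "(nat \<Rightarrow> nat \<Rightarrow> real) \<Rightarrow> nat \<Rightarrow> lp_row \<Rightarrow> real" where
  "LP_rhs p N r = (case r of Row_a j n \<Rightarrow> p j n | Row_b j n \<Rightarrow> p j n | Row_c j n \<Rightarrow> 0 | Row_d j n \<Rightarrow> 0
                | Row_e j n \<Rightarrow> (if n = N then p j n else 0))"

definition LP_cost :: "(real \<Rightarrow> real \<Rightarrow> real) \<Rightarrow> (nat \<Rightarrow> real) \<Rightarrow> (nat \<Rightarrow> real) \<Rightarrow> lp_var \<Rightarrow> real" where
  "LP_cost a x t v = (case v of Var_f j n \<Rightarrow> a (x j) (t n) | Var_g1 j k n \<Rightarrow> 0 | Var_g2 j k n \<Rightarrow> 0)"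

abbreviation LP_std_feasible :: "nat \<Rightarrow> nat \<Rightarrow> (nat \<Rightarrow> real) \<Rightarrow> (nat \<Rightarrow> nat \<Rightarrow> real) \<Rightarrow> (lp_var \<Rightarrow> real) \<Rightarrow> bool"
  where "LP_std_feasible J N x p \<equiv>
    lp_primal_feasible (LP_rows J N) (LP_eq_rows J N) (LP_vars J N) (LP_matrix x) (LP_rhs p N)"

abbreviation LH_std_feasible ::
  "nat \<Rightarrow> nat \<Rightarrow> (real \<Rightarrow> real \<Rightarrow> real) \<Rightarrow> (nat \<Rightarrow> real) \<Rightarrow> (nat \<Rightarrow> real) \<Rightarrow> (lp_row \<Rightarrow> real) \<Rightarrow> bool"
  where "LH_std_feasible J N a x t \<equiv>
    lp_dual_feasible (LP_rows J N) (LP_eq_rows J N) (LP_vars J N) (LP_matrix x) (LP_cost a x t)"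

lemma ball_image_curry2: "(\<forall>z\<in>(\<lambda>(a,b). f a b) ` (A \<times> B). P z) \<longleftrightarrow> (\<forall>a\<in>A. \<forall>b\<in>B. P (f a b))"
  by auto
lemma ball_image_curry3: "(\<forall>z\<in>(\<lambda>(a,b,c). f a b c) ` (A \<times> B \<times> C). P z) \<longleftrightarrow> (\<forall>a\<in>A. \<forall>b\<in>B. \<forall>c\<in>C. P (f a b c))"
  by auto

lemma ball_LP_vars:
  "(\<forall>v\<in>LP_vars J N. P v) \<longleftrightarrow> (\<forall>j\<le>J. \<forall>n\<in>{1..N}. P (Var_f j n))
    \<and> (\<forall>j\<le>J. \<forall>k\<le>J. \<forall>n\<in>{1..N-1}. P (Var_g1 j k n))
    \<and> (\<forall>j\<le>J. \<forall>k\<le>J. \<forall>n\<in>{1..N-1}. P (Var_g2 j k n))"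
  unfolding LP_vars_def ball_Un ball_image_curry2 ball_image_curry3 by (simp add: Ball_def) blast

lemma ball_LP_eq_rows:
  "(\<forall>r\<in>LP_eq_rows J N. P r) \<longleftrightarrow> (\<forall>j\<le>J. \<forall>n\<in>{1..N-1}. P (Row_a j n))
    \<and> (\<forall>j\<le>J. \<forall>n\<in>{2..N}. P (Row_b j n))
    \<and> (\<forall>j\<le>J. \<forall>n\<in>{1..N-1}. P (Row_c j n)) \<and> (\<forall>j\<le>J. \<forall>n\<in>{1..N-1}. P (Row_d j n))"
  unfolding LP_eq_rows_def ball_Un ball_image_curry2 by (simp add: Ball_def)

lemma ball_LP_ineq_rows: "(\<forall>r\<in>LP_ineq_rows J N. P r) \<longleftrightarrow> (\<forall>j\<le>J. \<forall>n\<in>{1..N}. P (Row_e j n))"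
  unfolding LP_ineq_rows_def ball_image_curry2 by (simp add: Ball_def)

lemma constraint_e_iff:
  fixes f G H P :: "nat \<Rightarrow> real"
  assumes "N \<ge> 1"
  shows "(\<forall>n\<in>{1..N}. f n - (if n < N then G n else 0) + (if 2 \<le> n then H n else 0)
            \<le> (if n = N then P n else 0))
    \<longleftrightarrow> (1 < N \<longrightarrow> f 1 - G 1 \<le> 0) \<and> (\<forall>n. 1 < n \<and> n < N \<longrightarrow> f n - G n + H n \<le> 0)
      \<and> f N + (if 1 < N then H N else 0) \<le> P N"
proof -
  have "{1..N} = {n. n = N \<or> n = 1 \<and> 1 < N \<or> 1 < n \<and> n < N}" using assms by auto
  then show ?thesis using assms by auto
qed

lemma LP_feasible_iff_LP_std_feasible:
  assumes N: "N \<ge> 1"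
  shows "LP_std_feasible J N x p y \<longleftrightarrow>
     LP_feasible N J x p (\<lambda>j n. y (Var_f j n)) (\<lambda>j k n. y (Var_g1 j k n)) (\<lambda>j k n. y (Var_g2 j k n))"
proof -
  have diff: "(LP_rows J N) - LP_eq_rows J N = LP_ineq_rows J N" by (rule LP_rows_disjoint(2))
  have rA: "(\<forall>j\<le>J. \<forall>n\<in>{1..N-1}.
      matvec (LP_vars J N) (LP_matrix x) y (Row_a j n) = LP_rhs p N (Row_a j n))
     \<longleftrightarrow> (\<forall>j\<le>J. \<forall>n\<in>{1..N-1}. (\<Sum>k\<le>J. y (Var_g1 j k n) + y (Var_g2 j k n)) = p j n)"
    using matvec_LP_row_a[of _ J _ N x y] by (auto simp: LP_rhs_def)
  have rB: "(\<forall>j\<le>J. \<forall>n\<in>{2..N}. matvec (LP_vars J N) (LP_matrix x) y (Row_b j n) = LP_rhs p N (Row_b j n))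
     \<longleftrightarrow> (\<forall>j\<le>J. \<forall>n\<in>{2..N}. (\<Sum>i\<le>J. y (Var_g1 i j (n-1)) + y (Var_g2 i j (n-1))) = p j n)"
    using matvec_LP_row_b[of _ J _ N x y] by (auto simp: LP_rhs_def)
  have rCD: "(\<forall>j\<le>J. \<forall>n\<in>{1..N-1}.
        matvec (LP_vars J N) (LP_matrix x) y (Row_c j n) = LP_rhs p N (Row_c j n)) \<and>
      (\<forall>j\<le>J. \<forall>n\<in>{1..N-1}.
        matvec (LP_vars J N) (LP_matrix x) y (Row_d j n) = LP_rhs p N (Row_d j n))
     \<longleftrightarrow> (\<forall>j\<le>J. \<forall>n\<in>{1..N-1}. (\<Sum>k\<le>J. (x k - x j) * y (Var_g1 j k n)) = 0
                           \<and> (\<Sum>k\<le>J. (x k - x j) * y (Var_g2 j k n)) = 0)"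
    using matvec_LP_row_c[of _ J _ N x y] matvec_LP_row_d[of _ J _ N x y] by (auto simp: LP_rhs_def)
  have rE: "(\<forall>j\<le>J. \<forall>n\<in>{1..N}. matvec (LP_vars J N) (LP_matrix x) y (Row_e j n) \<le> LP_rhs p N (Row_e j n))
     \<longleftrightarrow> (\<forall>j\<le>J.
        (1 < N \<longrightarrow> y (Var_f j 1) - (\<Sum>k\<le>J. y (Var_g2 j k 1)) \<le> 0) \<and>
        (\<forall>n. 1 < n \<and> n < N \<longrightarrow>
          y (Var_f j n) - (\<Sum>k\<le>J. y (Var_g2 j k n)) + (\<Sum>i\<le>J. y (Var_g2 i j (n-1))) \<le> 0) \<and>
        y (Var_f j N) + (if 1 < N then (\<Sum>i\<le>J. y (Var_g2 i j (N-1))) else 0) \<le> p j N)"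
  proof -
    have "(\<forall>n\<in>{1..N}. matvec (LP_vars J N) (LP_matrix x) y (Row_e j n) \<le> LP_rhs p N (Row_e j n)) \<longleftrightarrow>
       (\<forall>n\<in>{1..N}. y (Var_f j n) - (if n < N then (\<Sum>k\<le>J. y (Var_g2 j k n)) else 0)
           + (if 2 \<le> n then (\<Sum>i\<le>J. y (Var_g2 i j (n-1))) else 0) \<le> (if n = N then p j n else 0))"
      if "j \<le> J" for j
      using matvec_LP_row_e[OF that, of _ N x y] by (auto simp: LP_rhs_def)
    then show ?thesis
      using constraint_e_iff[OF N, of "\<lambda>n. y (Var_f _ n)"] by simp
  qed
  show ?thesis
    unfolding lp_primal_feasible_def LP_feasible_def diff ball_LP_vars ball_LP_eq_rows
      ball_LP_ineq_rows rA rB rCD rE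
    by blast
qed

definition LH_dual_vector ::
  "(nat \<Rightarrow> nat \<Rightarrow> real) \<Rightarrow> (nat \<Rightarrow> nat \<Rightarrow> real) \<Rightarrow> (nat \<Rightarrow> nat \<Rightarrow> real) \<Rightarrow> (nat \<Rightarrow> nat \<Rightarrow> real)
   \<Rightarrow> (nat \<Rightarrow> nat \<Rightarrow> real) \<Rightarrow> lp_row \<Rightarrow> real" where
  "LH_dual_vector e1 e2 v d1 d2 r = (case r of
       Row_a j n \<Rightarrow> e1 j n | Row_b j n \<Rightarrow> e2 j n | Row_c j n \<Rightarrow> d1 j n | Row_d j n \<Rightarrow> d2 j n
     | Row_e j n \<Rightarrow> v j n)"

lemma LH_std_feasible_imp_LH_feasible:
  assumes N: "N \<ge> 1" and d: "LH_std_feasible J N a x t u"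
  shows "LH_feasible N J a x t
    (\<lambda>j n. if n < N then u (Row_a j n) else 0) (\<lambda>j n. if 2 \<le> n then u (Row_b j n) else 0)
           (\<lambda>j n. u (Row_e j n)) (\<lambda>j n. u (Row_c j n)) (\<lambda>j n. u (Row_d j n))"
proof -
  have d1: "\<forall>j\<le>J. \<forall>n\<in>{1..N}. u (Row_e j n) \<ge> 0"
    and d2: "\<forall>v\<in>LP_vars J N. vecmat (LP_rows J N) (LP_matrix x) u v \<ge> LP_cost a x t v"
    using d unfolding lp_dual_feasible_def LP_rows_disjoint(2) ball_LP_ineq_rows by auto
  note d2' = d2[unfolded ball_LP_vars]
  show ?thesis unfolding LH_feasible_def
  proof (intro conjI allI impI ballI)
    fix j n assume j: "j \<le> J" and n: "n \<in> {1..N}"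
    show "u (Row_e j n) \<ge> 0" using d1 j n by blast
    have nn: "1 \<le> n" "n \<le> N" using n by auto
    have "LP_cost a x t (Var_f j n) \<le> vecmat (LP_rows J N) (LP_matrix x) u (Var_f j n)"
      using d2' j n by blast
    then show "u (Row_e j n) \<ge> a (x j) (t n)"
      using vecmat_LP_var_f[OF j nn, of x u] by (simp add: LP_cost_def)
  next
    fix j k n assume j: "j \<le> J" and k: "k \<le> J" and n: "n \<in> {1..N-1}"
    have nn: "1 \<le> n" "n < N" using n N by auto
    have "LP_cost a x t (Var_g1 j k n) \<le> vecmat (LP_rows J N) (LP_matrix x) u (Var_g1 j k n)"
      using d2' j k n by blast
    then show "0 \<le> (if n < N then u (Row_a j n) else 0) + (if 2 \<le> Suc n then u (Row_b k (Suc n)) else 0)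
      + (x k - x j) * u (Row_c j n)"
      using vecmat_LP_var_g1[OF j k nn, of x u] nn by (simp add: LP_cost_def)
    have "LP_cost a x t (Var_g2 j k n) \<le> vecmat (LP_rows J N) (LP_matrix x) u (Var_g2 j k n)"
      using d2' j k n by blast
    then show "0 \<le> (if n < N then u (Row_a j n) else 0) + (if 2 \<le> Suc n then u (Row_b k (Suc n)) else 0)
      + (x k - x j) * u (Row_d j n)
           - u (Row_e j n) + u (Row_e k (Suc n))"
      using vecmat_LP_var_g2[OF j k nn, of x u] nn by (simp add: LP_cost_def)
  qed auto
qed

lemma LH_feasible_imp_LH_std_feasible:
  assumes N: "N \<ge> 1" and h: "LH_feasible N J a x t e1 e2 v d1 d2"
  shows "LH_std_feasible J N a x t (LH_dual_vector e1 e2 v d1 d2)"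
proof -
  note h' = h[unfolded LH_feasible_def]
  let ?u = "LH_dual_vector e1 e2 v d1 d2"
  show ?thesis unfolding lp_dual_feasible_def LP_rows_disjoint(2) ball_LP_ineq_rows ball_LP_vars
  proof (intro conjI allI impI ballI)
    fix j n assume j: "j \<le> J" and n: "n \<in> {1..N}"
    show "?u (Row_e j n) \<ge> 0" using h' j n by (auto simp: LH_dual_vector_def)
    show "LP_cost a x t (Var_f j n) \<le> vecmat (LP_rows J N) (LP_matrix x) ?u (Var_f j n)"
      using h' j n vecmat_LP_var_f[OF j, of n N x] by (auto simp: LP_cost_def LH_dual_vector_def)
  next
    fix j k n assume j: "j \<le> J" and k: "k \<le> J" and n: "n \<in> {1..N-1}"
    have nn: "1 \<le> n" "n < N" using n N by auto
    show "LP_cost a x t (Var_g1 j k n) \<le> vecmat (LP_rows J N) (LP_matrix x) ?u (Var_g1 j k n)"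
      using h' j k n vecmat_LP_var_g1[OF j k nn, of x] by (auto simp: LP_cost_def LH_dual_vector_def)
    show "LP_cost a x t (Var_g2 j k n) \<le> vecmat (LP_rows J N) (LP_matrix x) ?u (Var_g2 j k n)"
      using h' j k n vecmat_LP_var_g2[OF j k nn, of x] by (auto simp: LP_cost_def LH_dual_vector_def)
  qed
qed

lemma LP_obj_eq_std:
  "(\<Sum>v\<in>LP_vars J N. LP_cost a x t v * y v) = LP_obj N J a x t (\<lambda>j n. y (Var_f j n))"
  unfolding sum_LP_vars LP_obj_def LP_cost_def by (simp, rule sum.swap)

lemma LH_obj_eq_std:
  assumes N: "N \<ge> 1" and z: "\<forall>j\<le>J. e1 j N = 0 \<and> e2 j 1 = 0"
  shows "LH_obj N J p e1 e2 v = (\<Sum>r\<in>LP_rows J N. LP_rhs p N r * LH_dual_vector e1 e2 v d1 d2 r)"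
proof -
  have s1: "{1..N} = insert N {1..N-1}" using N by auto
  have s2: "{1..N} = insert 1 {2..N}" using N by auto
  have A1: "(\<Sum>n\<in>{1..N}. e1 j n * p j n) = (\<Sum>n\<in>{1..N-1}. p j n * e1 j n)" if "j \<le> J" for j
    using z that N by (subst s1, subst sum.insert) (auto simp: mult.commute)
  have A2: "(\<Sum>n\<in>{1..N}. e2 j n * p j n) = (\<Sum>n\<in>{2..N}. p j n * e2 j n)" if "j \<le> J" for j
    using z that N by (subst s2, subst sum.insert) (auto simp: mult.commute)
  have A3: "(\<Sum>n\<in>{1..N}. (if n = N then p j n else 0) * v j n) = v j N * p j N" for j
    using N by (simp add: if_mult0 sum.delta)
  have "LH_obj N J p e1 e2 v = (\<Sum>j\<le>J. \<Sum>n\<in>{1..N}. e1 j n * p j n) + (\<Sum>j\<le>J. \<Sum>n\<in>{1..N}. e2 j n * p j n)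
      + (\<Sum>j\<le>J. v j N * p j N)"
  proof -
    have "(\<Sum>n\<in>{1..N}. \<Sum>j\<le>J. e1 j n * p j n) = (\<Sum>j\<le>J. \<Sum>n\<in>{1..N}. e1 j n * p j n)"
      by (rule sum.swap)
    moreover have "(\<Sum>n\<in>{1..N}. \<Sum>j\<le>J. e2 j n * p j n) = (\<Sum>j\<le>J. \<Sum>n\<in>{1..N}. e2 j n * p j n)"
      by (rule sum.swap)
    ultimately show ?thesis unfolding LH_obj_def by (simp add: distrib_right sum.distrib)
  qed
  also have "\<dots> = (\<Sum>j\<le>J. \<Sum>n\<in>{1..N-1}. p j n * e1 j n) + (\<Sum>j\<le>J. \<Sum>n\<in>{2..N}. p j n * e2 j n)
      + (\<Sum>j\<le>J. \<Sum>n\<in>{1..N}. (if n = N then p j n else 0) * v j n)"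
    using A1 A2 A3 by simp
  also have "\<dots> = (\<Sum>r\<in>LP_rows J N. LP_rhs p N r * LH_dual_vector e1 e2 v d1 d2 r)"
    unfolding sum_LP_rows sum_LP_eq_rows sum_LP_ineq_rows by (simp add: LP_rhs_def LH_dual_vector_def)
  finally show ?thesis .
qed

section \<open>Duality between \<open>L_P\<close> and \<open>L_H\<close>\<close>

definition LP_vector ::
  "(nat \<Rightarrow> nat \<Rightarrow> real) \<Rightarrow> (nat \<Rightarrow> nat \<Rightarrow> nat \<Rightarrow> real) \<Rightarrow> (nat \<Rightarrow> nat \<Rightarrow> nat \<Rightarrow> real) \<Rightarrow> lp_var \<Rightarrow> real" where
  "LP_vector f g1 g2 v =
     (case v of Var_f j n \<Rightarrow> f j n | Var_g1 j k n \<Rightarrow> g1 j k n | Var_g2 j k n \<Rightarrow> g2 j k n)"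

lemma LP_feasible_iff_LP_vector:
  assumes "N \<ge> 1"
  shows "LP_feasible N J x p f g1 g2 \<longleftrightarrow> LP_std_feasible J N x p (LP_vector f g1 g2)"
  using LP_feasible_iff_LP_std_feasible[OF assms, of J x p "LP_vector f g1 g2"]
  by (simp add: LP_vector_def)

lemma LP_obj_le_LH_obj:
  assumes N: "N \<ge> 1" and P: "LP_feasible N J x p f g1 g2" and H: "LH_feasible N J a x t e1 e2 v d1 d2"
  shows "LP_obj N J a x t f \<le> LH_obj N J p e1 e2 v"
proof -
  have "LP_obj N J a x t f = (\<Sum>w\<in>LP_vars J N. LP_cost a x t w * LP_vector f g1 g2 w)"
    using LP_obj_eq_std[where y = "LP_vector f g1 g2"] by (simp add: LP_vector_def)
  also have "\<dots> \<le> (\<Sum>r\<in>LP_rows J N. LP_rhs p N r * LH_dual_vector e1 e2 v d1 d2 r)"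
    using P unfolding LP_feasible_iff_LP_vector[OF N]
    by (intro weak_duality[OF _ _ _ _ LH_feasible_imp_LH_std_feasible[OF N H]])
      (auto simp: finite_LP_sets)
  also have "\<dots> = LH_obj N J p e1 e2 v"
    using H unfolding LH_feasible_def by (intro LH_obj_eq_std[OF N, symmetric]) blast
  finally show ?thesis .
qed

lemma LH_std_feasible_imp_LH:
  assumes N: "N \<ge> 1"
    and u: "LH_std_feasible J N a x t u"
  shows "\<exists>e1 e2 v d1 d2. LH_feasible N J a x t e1 e2 v d1 d2
    \<and> LH_obj N J p e1 e2 v = (\<Sum>r\<in>LP_rows J N. LP_rhs p N r * u r)"
proof (intro exI conjI)
  let ?e1 = "\<lambda>j n. if n < N then u (Row_a j n) else 0"
    and ?e2 = "\<lambda>j n. if 2 \<le> n then u (Row_b j n) else 0"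
    and ?v = "\<lambda>j n. u (Row_e j n)" and ?d1 = "\<lambda>j n. u (Row_c j n)" and ?d2 = "\<lambda>j n. u (Row_d j n)"
  show "LH_feasible N J a x t ?e1 ?e2 ?v ?d1 ?d2"
    by (rule LH_std_feasible_imp_LH_feasible[OF N u])
  have "LH_dual_vector ?e1 ?e2 ?v ?d1 ?d2 r = u r" if "r \<in> LP_rows J N" for r
    using that N unfolding LP_eq_rows_def LP_ineq_rows_def by (auto simp: LH_dual_vector_def)
  then show "LH_obj N J p ?e1 ?e2 ?v = (\<Sum>r\<in>LP_rows J N. LP_rhs p N r * u r)"
    using LH_obj_eq_std[OF N, of J ?e1 ?e2 p ?v ?d1 ?d2] by simp
qed

lemma LP_rhs_nonneg_on_dual_cone:
  assumes md: "market_data N J t s0 x c" and p: "p = pr J s0 x c"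
    and u_nonneg: "\<forall>r\<in>LP_ineq_rows J N. u r \<ge> 0"
    and u_cone: "\<forall>w\<in>LP_vars J N. vecmat (LP_rows J N) (LP_matrix x) u w \<ge> 0"
  shows "(\<Sum>r\<in>LP_rows J N. LP_rhs p N r * u r) \<ge> 0"
proof -
  have N: "N \<ge> 1" using market_dataD(1)[OF md] .
  have step: "(\<Sum>j\<le>J. p j n * u (Row_a j n)) + (\<Sum>k\<le>J. p k (Suc n) * u (Row_b k (Suc n))) \<ge> 0"
    if n: "1 \<le> n" "n < N" for n
  proof -
    have "u (Row_a j n) + u (Row_b k (Suc n)) + (x k - x j) * u (Row_c j n) \<ge> 0"
      if "j \<le> J" "k \<le> J" for j k
    proof -
      have "n \<in> {1..N-1}" using n by auto
      then have "vecmat (LP_rows J N) (LP_matrix x) u (Var_g1 j k n) \<ge> 0"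
        using u_cone that unfolding ball_LP_vars by blast
      then show ?thesis using vecmat_LP_var_g1[OF that n, of x u] by simp
    qed
    from convex_order_dual_nonneg[OF md n this] show ?thesis unfolding p .
  qed
  have shift: "(\<Sum>n\<in>{2..N}. p j n * u (Row_b j n))
      = (\<Sum>n\<in>{1..N-1}. p j (Suc n) * u (Row_b j (Suc n)))" for j
  proof -
    have e: "{2..N} = Suc ` {1..N-1}" using N by (auto simp: image_iff intro!: bexI[of _ "_ - 1"])
    show ?thesis unfolding e by (subst sum.reindex) auto
  qed
  have "0 \<le> (\<Sum>n\<in>{1..N-1}. (\<Sum>j\<le>J. p j n * u (Row_a j n)) + (\<Sum>k\<le>J. p k (Suc n) * u (Row_b k (Suc n))))"
    using step by (intro sum_nonneg) auto
  also have "\<dots> = (\<Sum>j\<le>J. \<Sum>n\<in>{1..N-1}. p j n * u (Row_a j n)) + (\<Sum>j\<le>J. \<Sum>n\<in>{2..N}. p j n * u (Row_b j n))"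
    unfolding shift sum.distrib
    by (rule arg_cong2[where f = "(+)"]; rule sum.swap)
  also have "\<dots> \<le> (\<Sum>r\<in>LP_rows J N. LP_rhs p N r * u r)"
  proof -
    have "0 \<le> (\<Sum>j\<le>J. \<Sum>n\<in>{1..N}. (if n = N then p j n else 0) * u (Row_e j n))"
      using u_nonneg pr_nonneg[OF md] unfolding ball_LP_ineq_rows p by (intro sum_nonneg) auto
    then show ?thesis unfolding sum_LP_rows sum_LP_eq_rows sum_LP_ineq_rows by (simp add: LP_rhs_def)
  qed
  finally show ?thesis .
qed

lemma LP_std_feasible_exists:
  assumes md: "market_data N J t s0 x c" and p: "p = pr J s0 x c"
  shows "\<exists>y. LP_std_feasible J N x p y"
proof -
  let ?I = "LP_rows J N"
  have "finite ?I" "finite (LP_vars J N)" "LP_eq_rows J N \<subseteq> ?I" "LP_vars J N \<subseteq> LP_vars J N"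
    by (auto simp: finite_LP_sets)
  from farkas_lemma[OF this, of "LP_matrix x" "LP_rhs p N"] show ?thesis
  proof (elim disjE exE conjE)
    fix u assume cone: "\<forall>r\<in>?I - LP_eq_rows J N. u r \<ge> 0"
      "\<forall>w\<in>LP_vars J N. vecmat ?I (LP_matrix x) u w \<ge> 0"
      and neg: "(\<Sum>r\<in>?I. LP_rhs p N r * u r) < 0"
    from cone have "(\<Sum>r\<in>?I. LP_rhs p N r * u r) \<ge> 0"
      unfolding LP_rows_disjoint(2) by (rule LP_rhs_nonneg_on_dual_cone[OF md p])
    with neg show ?thesis by simp
  qed (auto simp: lp_primal_feasible_def)
qed

text \<open>Any upper bound \<open>M\<ge>0\<close> of the payoff gives the dual feasible point \<open>v = M\<close>, all other
  variables zero.\<close>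

lemma LH_std_feasible_exists:
  assumes N: "N \<ge> 1" and a: "\<forall>j\<le>J. \<forall>n\<in>{1..N}. a (x j) (t n) \<ge> 0"
  shows "\<exists>u. LH_std_feasible J N a x t u"
proof
  define M where "M = (\<Sum>j\<le>J. \<Sum>n\<in>{1..N}. a (x j) (t n))"
  have "M \<ge> 0" unfolding M_def using a by (intro sum_nonneg) auto
  have a_le_M: "a (x j) (t n) \<le> M" if j: "j \<le> J" and n: "n \<in> {1..N}" for j n
  proof -
    have "a (x j) (t n) \<le> (\<Sum>n\<in>{1..N}. a (x j) (t n))"
      using a j n by (intro member_le_sum) auto
    also have "\<dots> \<le> M" unfolding M_def
      using a j by (intro member_le_sum[where f = "\<lambda>j. \<Sum>n\<in>{1..N}. a (x j) (t n)"] sum_nonneg) auto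
    finally show ?thesis .
  qed
  let ?u = "\<lambda>r. case r of Row_e j n \<Rightarrow> M | _ \<Rightarrow> 0"
  show "LH_std_feasible J N a x t ?u"
    unfolding lp_dual_feasible_def LP_rows_disjoint(2) ball_LP_ineq_rows ball_LP_vars
  proof (intro conjI allI impI ballI)
    fix j n assume j: "j \<le> J" and n: "n \<in> {1..N}"
    then show "?u (Row_e j n) \<ge> 0"
      "LP_cost a x t (Var_f j n) \<le> vecmat (LP_rows J N) (LP_matrix x) ?u (Var_f j n)"
      using \<open>M \<ge> 0\<close> a_le_M vecmat_LP_var_f[OF j, of n N x ?u] by (auto simp: LP_cost_def)
  next
    fix j k n assume j: "j \<le> J" and k: "k \<le> J" and n: "n \<in> {1..N-1}"
    then have "1 \<le> n" "n < N" by auto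
    then show "LP_cost a x t (Var_g1 j k n) \<le> vecmat (LP_rows J N) (LP_matrix x) ?u (Var_g1 j k n)"
      "LP_cost a x t (Var_g2 j k n) \<le> vecmat (LP_rows J N) (LP_matrix x) ?u (Var_g2 j k n)"
      using vecmat_LP_var_g1[OF j k, of n N x ?u] vecmat_LP_var_g2[OF j k, of n N x ?u]
      by (simp_all add: LP_cost_def)
  qed
qed

lemma exists_LP_LH_equal_objectives:
  assumes md: "market_data N J t s0 x c" and a: "\<forall>j\<le>J. \<forall>n\<in>{1..N}. a (x j) (t n) \<ge> 0"
    and p: "p = pr J s0 x c"
  shows "\<exists>f g1 g2 e1 e2 v d1 d2. LP_feasible N J x p f g1 g2 \<and> LH_feasible N J a x t e1 e2 v d1 d2
    \<and> LH_obj N J p e1 e2 v = LP_obj N J a x t f"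
proof -
  have N: "N \<ge> 1" using market_dataD(1)[OF md] .
  obtain y u where
    y: "LP_std_feasible J N x p y"
    and u: "LH_std_feasible J N a x t u"
    and eq: "(\<Sum>w\<in>LP_vars J N. LP_cost a x t w * y w) = (\<Sum>r\<in>LP_rows J N. LP_rhs p N r * u r)"
  proof -
    obtain y0 u0 where
      "LP_std_feasible J N x p y0"
      "LH_std_feasible J N a x t u0"
      using LP_std_feasible_exists[OF md p] LH_std_feasible_exists[OF N a] by blast
    from lp_strong_duality[OF _ _ _ this] show ?thesis
      using that by (auto simp: finite_LP_sets)
  qed
  obtain e1 e2 v d1 d2 where "LH_feasible N J a x t e1 e2 v d1 d2"
    "LH_obj N J p e1 e2 v = (\<Sum>r\<in>LP_rows J N. LP_rhs p N r * u r)"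
    using LH_std_feasible_imp_LH[OF N u] by blast
  moreover have "\<dots> = LP_obj N J a x t (\<lambda>j n. y (Var_f j n))"
    using eq LP_obj_eq_std[where y = y] by simp
  moreover have
    "LP_feasible N J x p (\<lambda>j n. y (Var_f j n)) (\<lambda>j k n. y (Var_g1 j k n)) (\<lambda>j k n. y (Var_g2 j k n))"
    using LP_feasible_iff_LP_std_feasible[OF N] y by blast
  ultimately show ?thesis by (intro exI conjI) auto
qed

theorem mainTheorem5:
  fixes N J :: nat and t x :: "nat \<Rightarrow> real" and s0 :: real
    and c :: "nat \<Rightarrow> nat \<Rightarrow> real" and a :: "real \<Rightarrow> real \<Rightarrow> real"
  assumes "market_data N J t s0 x c"
    and "\<forall>j\<le>J. \<forall>n\<in>{1..N}. a (x j) (t n) \<ge> 0"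
  defines "p \<equiv> pr J s0 x c"
  shows "\<exists>f g1 g2 e1 e2 v d1 d2.
           LP_feasible N J x p f g1 g2 \<and>
           (\<forall>f' g1' g2'. LP_feasible N J x p f' g1' g2' \<longrightarrow> LP_obj N J a x t f' \<le> LP_obj N J a x t f) \<and>
           LH_feasible N J a x t e1 e2 v d1 d2 \<and>
           (\<forall>e1' e2' v' d1' d2'. LH_feasible N J a x t e1' e2' v' d1' d2' \<longrightarrow>
               LH_obj N J p e1 e2 v \<le> LH_obj N J p e1' e2' v') \<and>
           LH_obj N J p e1 e2 v = LP_obj N J a x t f"
proof -
  have N: "N \<ge> 1" using market_dataD(1)[OF assms(1)] .
  obtain f g1 g2 e1 e2 v d1 d2
    where P: "LP_feasible N J x p f g1 g2" and H: "LH_feasible N J a x t e1 e2 v d1 d2"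
    and eq: "LH_obj N J p e1 e2 v = LP_obj N J a x t f"
    using exists_LP_LH_equal_objectives[OF assms(1,2) meta_eq_to_obj_eq[OF p_def]] by blast
  have "LP_obj N J a x t f' \<le> LP_obj N J a x t f" if "LP_feasible N J x p f' g1' g2'" for f' g1' g2'
    using LP_obj_le_LH_obj[OF N that H] eq by simp
  moreover have "LH_obj N J p e1 e2 v \<le> LH_obj N J p e1' e2' v'"
    if "LH_feasible N J a x t e1' e2' v' d1' d2'" for e1' e2' v' d1' d2'
    using LP_obj_le_LH_obj[OF N P that] eq by simp
  ultimately show ?thesis using P H eq by blast
qed

end
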